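(* Let $M$ be a matroid on a finite ground set $E$ with collection of bases $\mathcal{B}$, let $M^\ast$ be its dual matroid with collection of independent sets $\mathcal{I}^\ast$, and let $\preceq$ be a total order on $E$. Then the BDD $\mathsf{B}(\mathcal{I}^\ast)$ with respect to $(E,\preceq)$ is obtained from the ZDD $\mathsf{Z}(\mathcal{B})$ with respect to $(E,\preceq)$ by setting $(\nu_0,\nu_1)\gets(\nu_1,\nu_0)$ (swapping the 0-arc and 1-arc) at every non-terminal node $\nu$.
   Context: The dual $M^\ast$ of $M$ has ground set $E$ and bases $\{E\setminus B: B\in\mathcal{B}\}$. A decision diagram over $(E,\preceq)$ is a directed acyclic graph with a unique root, at most two terminal nodes, the 0-terminal $\bot$ and the 1-terminal $\top$, and non-terminal nodes $\nu$, each with a label $\ell(\nu)\in E$ and exactly two outgoing arcs, the 0-arc $(\nu,\nu_0)$ and the 1-arc $(\nu,\nu_1)$, with $\ell(\nu)\prec\ell(\nu_0),\ell(\nu_1)$ (terminal labels regarded as larger than all elements of $E$). A 1-path is a directed path from the root to $\top$. Under BDD semantics a 1-path represents all $X\subseteq E$ containing the label of the tail of every 1-arc on the path and no label of the tail of any 0-arc on the path; under ZDD semantics it represents the single set of labels of tails of the 1-arcs on the path; the diagram represents the union. The BDD $\mathsf{B}(\mathcal{S})$ (resp. ZDD $\mathsf{Z}(\mathcal{S})$) of $\mathcal{S}\subseteq 2^E$ is the unique diagram obtained from the complete binary decision tree of $\mathcal{S}$ (internal nodes at depth $j$ labeled by the $(j+1)$-th smallest element of $E$; the leaf reached by taking 1-arcs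 exactly at the elements of $X$ is $\top$ iff $X\in\mathcal{S}$, else $\bot$) by exhaustively applying: (NS) merge non-terminal nodes with the same label, same 0-successor and same 1-successor; and for BDDs (B-ND) remove every non-terminal $\nu$ with $\nu_0=\nu_1$, redirecting arcs entering $\nu$ to $\nu_0$; for ZDDs (Z-ND) remove every non-terminal $\nu$ with $\nu_1=\bot$, redirecting arcs entering $\nu$ to $\nu_0$. *)

theory Defs
  imports Main
begin

section \<open>Matroids and their duals\<close>

locale matroid =
  fixes E :: "'a set" and \<B> :: "'a set set"
  assumes finite_ground: "finite E"
    and bases_subset: "\<B> \<subseteq> Pow E"
    and bases_nonempty: "\<B> \<noteq> {}"
    and basis_exchange:
      "\<lbrakk>B1 \<in> \<B>; B2 \<in> \<B>; x \<in> B1 - B2\<rbrakk> \<Longrightarrow> \<exists>y \<in> B2 - B1. insert y (B1 - {x}) \<in> \<B>"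

definition indep_sets :: "'a set set \<Rightarrow> 'a set set" where
  "indep_sets \<B> = {I. \<exists>B \<in> \<B>. I \<subseteq> B}"

definition dual_bases :: "'a set \<Rightarrow> 'a set set \<Rightarrow> 'a set set" where
  "dual_bases E \<B> = {E - B | B. B \<in> \<B>}"

section \<open>Decision diagrams\<close>

datatype 'v node = Bot | Top | Inner 'v

text \<open>
  The field \<open>inner\<close> is the set of non-terminal nodes. A terminal belongs to a diagram iff it is
  the root or a successor of a non-terminal node, so a terminal that loses its last incoming arc
  during a reduction disappears. The fields \<open>lbl\<close>, \<open>succ0\<close> and \<open>succ1\<close> are meaningful on \<open>inner\<close> only.
\<close>

record ('v, 'a) diagram =
  inner :: "'v set"
  start :: "'v node"
  lbl :: "'v \<Rightarrow> 'a"
  succ0 :: "'v \<Rightarrow> 'v node"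
  succ1 :: "'v \<Rightarrow> 'v node"

text \<open>Isomorphism of labelled diagrams; terminals are mapped to themselves by \<open>map_node\<close>.\<close>

definition diagram_iso :: "('v, 'a) diagram \<Rightarrow> ('w, 'a) diagram \<Rightarrow> bool" (infix "\<simeq>" 50) where
  "D \<simeq> D' \<longleftrightarrow> (\<exists>f. bij_betw f (inner D) (inner D') \<and>
     start D' = map_node f (start D) \<and>
     (\<forall>v \<in> inner D. lbl D' (f v) = lbl D v \<and>
        succ0 D' (f v) = map_node f (succ0 D v) \<and>
        succ1 D' (f v) = map_node f (succ1 D v)))"

definition swap_arcs :: "('v, 'a) diagram \<Rightarrow> ('v, 'a) diagram" where
  "swap_arcs D = D\<lparr>succ0 := succ1 D, succ1 := succ0 D\<rparr>"

section \<open>The complete binary decision tree\<close>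

text \<open>The element of \<open>E\<close> with exactly \<open>j\<close> strictly smaller elements; \<open>j\<close> counts from \<open>0\<close>.\<close>

definition nth_smallest :: "'a set \<Rightarrow> 'a rel \<Rightarrow> nat \<Rightarrow> 'a" where
  "nth_smallest E r j = (THE e. e \<in> E \<and> card {x \<in> E. (x, e) \<in> r \<and> x \<noteq> e} = j)"

text \<open>
  A node of the tree is the list of arcs (\<open>True\<close> for a 1-arc) leading to it from the root; the
  lists of length \<open>card E\<close> are the leaves, which are identified with the two terminals.
\<close>

definition path_set :: "'a set \<Rightarrow> 'a rel \<Rightarrow> bool list \<Rightarrow> 'a set" where
  "path_set E r p = {nth_smallest E r j | j. j < length p \<and> p ! j}"

definition tree_node :: "'a set \<Rightarrow> 'a rel \<Rightarrow> 'a set set \<Rightarrow> bool list \<Rightarrow> bool list node" where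
  "tree_node E r S p =
     (if length p < card E then Inner p else if path_set E r p \<in> S then Top else Bot)"

definition decision_tree :: "'a set \<Rightarrow> 'a rel \<Rightarrow> 'a set set \<Rightarrow> (bool list, 'a) diagram" where
  "decision_tree E r S =
     \<lparr>inner = {p. length p < card E},
      start = tree_node E r S [],
      lbl = (\<lambda>p. nth_smallest E r (length p)),
      succ0 = (\<lambda>p. tree_node E r S (p @ [False])),
      succ1 = (\<lambda>p. tree_node E r S (p @ [True]))\<rparr>"

section \<open>Reduction\<close>

text \<open>Delete \<open>v\<close> and redirect all arcs entering it (and the root pointer) to \<open>w\<close>.\<close>

definition replace_node :: "'v \<Rightarrow> 'v node \<Rightarrow> ('v, 'a) diagram \<Rightarrow> ('v, 'a) diagram" where
  "replace_node v w D =
     (let \<sigma> = (\<lambda>x. if x = Inner v then w else x)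
      in D\<lparr>inner := inner D - {v}, start := \<sigma> (start D),
           succ0 := \<sigma> \<circ> succ0 D, succ1 := \<sigma> \<circ> succ1 D\<rparr>)"

inductive ns_step :: "('v, 'a) diagram \<Rightarrow> ('v, 'a) diagram \<Rightarrow> bool" where
  "\<lbrakk>u \<in> inner D; v \<in> inner D; u \<noteq> v; lbl D u = lbl D v;
    succ0 D u = succ0 D v; succ1 D u = succ1 D v\<rbrakk>
   \<Longrightarrow> ns_step D (replace_node v (Inner u) D)"

inductive bnd_step :: "('v, 'a) diagram \<Rightarrow> ('v, 'a) diagram \<Rightarrow> bool" where
  "\<lbrakk>v \<in> inner D; succ0 D v = succ1 D v\<rbrakk> \<Longrightarrow> bnd_step D (replace_node v (succ0 D v) D)"

inductive znd_step :: "('v, 'a) diagram \<Rightarrow> ('v, 'a) diagram \<Rightarrow> bool" where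
  "\<lbrakk>v \<in> inner D; succ1 D v = Bot\<rbrakk> \<Longrightarrow> znd_step D (replace_node v (succ0 D v) D)"

definition bdd_step :: "('v, 'a) diagram \<Rightarrow> ('v, 'a) diagram \<Rightarrow> bool" where
  "bdd_step D D' \<longleftrightarrow> ns_step D D' \<or> bnd_step D D'"

definition zdd_step :: "('v, 'a) diagram \<Rightarrow> ('v, 'a) diagram \<Rightarrow> bool" where
  "zdd_step D D' \<longleftrightarrow> ns_step D D' \<or> znd_step D D'"

definition exhausts_to :: "('d \<Rightarrow> 'd \<Rightarrow> bool) \<Rightarrow> 'd \<Rightarrow> 'd \<Rightarrow> bool" where
  "exhausts_to step D D' \<longleftrightarrow> step\<^sup>*\<^sup>* D D' \<and> (\<nexists>D''. step D' D'')"

text \<open>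
  Different reduction orders retain different representatives of merged nodes, so the result is
  unique only up to \<open>\<simeq>\<close>; the choice operator picks one of the results.
\<close>

definition BDD :: "'a set \<Rightarrow> 'a rel \<Rightarrow> 'a set set \<Rightarrow> (bool list, 'a) diagram" where
  "BDD E r S = (SOME D. exhausts_to bdd_step (decision_tree E r S) D)"

definition ZDD :: "'a set \<Rightarrow> 'a rel \<Rightarrow> 'a set set \<Rightarrow> (bool list, 'a) diagram" where
  "ZDD E r S = (SOME D. exhausts_to zdd_step (decision_tree E r S) D)"

lemma exhausts_to_exists:
  fixes D :: "('v, 'a) diagram"
  assumes fin: "finite (inner D)"
    and step: "\<And>D D'. step D D' \<Longrightarrow> \<exists>v \<in> inner D. inner D' = inner D - {v}"
  shows "\<exists>D'. exhausts_to step D D'"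
  using fin
proof (induction "card (inner D)" arbitrary: D rule: less_induct)
  case less
  show ?case
  proof (cases "\<exists>D1. step D D1")
    case True
    then obtain D1 where D1: "step D D1" by blast
    from step[OF D1] obtain v where v: "v \<in> inner D" "inner D1 = inner D - {v}" ..
    have "card (inner D1) < card (inner D)"
      unfolding v(2) using less.prems v(1) by (rule card_Diff1_less)
    moreover have "finite (inner D1)"
      unfolding v(2) using less.prems by (rule finite_Diff)
    ultimately obtain D' where "exhausts_to step D1 D'" using less.hyps by blast
    then have "exhausts_to step D D'"
      using converse_rtranclp_into_rtranclp[of step, OF D1] by (simp add: exhausts_to_def)
    then show ?thesis ..
  next
    case False
    then have "exhausts_to step D D" by (simp add: exhausts_to_def)
    then show ?thesis ..
  qed
qed

lemma finite_decision_tree: "finite (inner (decision_tree E r S))"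
proof -
  have "{p :: bool list. length p < card E} \<subseteq> {p. set p \<subseteq> UNIV \<and> length p \<le> card E}"
    by auto
  then show ?thesis
    using finite_subset[OF _ finite_lists_length_le[of "UNIV :: bool set" "card E"]]
    by (simp add: decision_tree_def)
qed

lemma inner_replace_node: "inner (replace_node v w D) = inner D - {v}"
  by (simp add: replace_node_def Let_def)

lemma bdd_step_inner: "bdd_step D D' \<Longrightarrow> \<exists>v \<in> inner D. inner D' = inner D - {v}"
  unfolding bdd_step_def
  by (elim disjE ns_step.cases bnd_step.cases) (hypsubst, rule bexI, rule inner_replace_node, assumption)+

lemma zdd_step_inner: "zdd_step D D' \<Longrightarrow> \<exists>v \<in> inner D. inner D' = inner D - {v}"
  unfolding zdd_step_def
  by (elim disjE ns_step.cases znd_step.cases) (hypsubst, rule bexI, rule inner_replace_node, assumption)+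

lemma exhausts_to_BDD: "exhausts_to bdd_step (decision_tree E r S) (BDD E r S)"
  unfolding BDD_def
  by (rule someI_ex, rule exhausts_to_exists[OF finite_decision_tree bdd_step_inner])

lemma exhausts_to_ZDD: "exhausts_to zdd_step (decision_tree E r S) (ZDD E r S)"
  unfolding ZDD_def
  by (rule someI_ex, rule exhausts_to_exists[OF finite_decision_tree zdd_step_inner])

end

theory Submission
  imports Defs
begin

text \<open>
  A decision diagram unfolds to a binary tree. Merging nodes does not change the unfoldings of the
  remaining nodes, and the deletion rules do not change their bottom-up normal forms with respect to
  deletion. In an exhausted diagram distinct nodes have distinct unfoldings, and these are normal;
  so the non-terminal nodes correspond to the inner subtrees of the normal form of the complete
  decision tree, which therefore determines the diagram up to isomorphism.

  It remains to compare two normal forms. Suppose that some elements have been decided, let \<open>Q\<close> be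
  the set of those put into the dual independent set, and let \<open>P\<close> be a maximal independent subset of
  the other decided elements. Then the normal form of the remaining decision tree of the dual
  independent sets at \<open>Q\<close> is the mirror image of that of the bases at \<open>P\<close>. If the next element is
  spanned by \<open>P\<close>, both rules delete the node. Otherwise the two subtrees on the basis side agree
  only if both are empty, since bases are equicardinal, and by basis extension both are empty as
  soon as the one of the 1-arc is; hence again the two deletion rules apply simultaneously.
\<close>

section \<open>Binary trees and their normal forms\<close>

datatype 'a dtree = Leaf bool | Branch 'a "'a dtree" "'a dtree"

primrec mirror :: "'a dtree \<Rightarrow> 'a dtree" where
  "mirror (Leaf b) = Leaf b"
| "mirror (Branch a l r) = Branch a (mirror r) (mirror l)"

lemma mirror_mirror [simp]: "mirror (mirror t) = t"
  by (induction t) auto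

lemma mirror_eq_iff [simp]: "mirror s = mirror t \<longleftrightarrow> s = t"
  by (metis mirror_mirror)

primrec subtrees :: "'a dtree \<Rightarrow> 'a dtree set" where
  "subtrees (Leaf b) = {Leaf b}"
| "subtrees (Branch a l r) = insert (Branch a l r) (subtrees l \<union> subtrees r)"

lemma self_in_subtrees [simp]: "t \<in> subtrees t"
  by (cases t) auto

lemma subtrees_trans: "s \<in> subtrees t \<Longrightarrow> u \<in> subtrees s \<Longrightarrow> u \<in> subtrees t"
  by (induction t) auto

lemma subtrees_mirror: "subtrees (mirror t) = mirror ` subtrees t"
  by (induction t) auto

primrec normal_form :: "('a dtree \<Rightarrow> 'a dtree \<Rightarrow> bool) \<Rightarrow> 'a dtree \<Rightarrow> 'a dtree" where
  "normal_form del (Leaf b) = Leaf b"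
| "normal_form del (Branch a l r) =
     (if del (normal_form del l) (normal_form del r) then normal_form del l
      else Branch a (normal_form del l) (normal_form del r))"

abbreviation (input) zdd_del :: "'a dtree \<Rightarrow> 'a dtree \<Rightarrow> bool" where
  "zdd_del l r \<equiv> r = Leaf False"

abbreviation bdd_normal_form :: "'a dtree \<Rightarrow> 'a dtree" where
  "bdd_normal_form \<equiv> normal_form (=)"

abbreviation zdd_normal_form :: "'a dtree \<Rightarrow> 'a dtree" where
  "zdd_normal_form \<equiv> normal_form zdd_del"

section \<open>Unfolding a diagram\<close>

inductive unfolds :: "('v, 'a) diagram \<Rightarrow> 'v node \<Rightarrow> 'a dtree \<Rightarrow> bool" for D where
  unfolds_Bot: "unfolds D Bot (Leaf False)"
| unfolds_Top: "unfolds D Top (Leaf True)"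
| unfolds_Inner: "\<lbrakk>v \<in> inner D; unfolds D (succ0 D v) l; unfolds D (succ1 D v) r\<rbrakk>
    \<Longrightarrow> unfolds D (Inner v) (Branch (lbl D v) l r)"

inductive_simps unfolds_Bot_iff [simp]: "unfolds D Bot t"
inductive_simps unfolds_Top_iff [simp]: "unfolds D Top t"
inductive_simps unfolds_Inner_iff: "unfolds D (Inner v) t"
inductive_simps unfolds_Leaf_iff: "unfolds D x (Leaf b)"
inductive_simps unfolds_Branch_iff: "unfolds D x (Branch a l r)"

lemma unfolds_unique: "unfolds D x s \<Longrightarrow> unfolds D x t \<Longrightarrow> s = t"
proof (induction arbitrary: t rule: unfolds.induct)
  case (unfolds_Inner v l r)
  from unfolds_Inner.prems obtain l' r' where t: "t = Branch (lbl D v) l' r'"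
    and l': "unfolds D (succ0 D v) l'" and r': "unfolds D (succ1 D v) r'"
    unfolding unfolds_Inner_iff by blast
  show ?case unfolding t using unfolds_Inner.IH(1)[OF l'] unfolds_Inner.IH(2)[OF r'] by simp
qed simp_all

lemma unfolds_subtree:
  assumes "unfolds D x t" "s \<in> subtrees t"
  shows "\<exists>y. unfolds D y s"
  using assms by induction (auto intro: unfolds.intros)

definition node_tree :: "('v, 'a) diagram \<Rightarrow> 'v \<Rightarrow> 'a dtree" where
  "node_tree D v = (THE s. unfolds D (Inner v) s)"

lemma node_tree_eq: "unfolds D (Inner v) s \<Longrightarrow> node_tree D v = s"
  unfolding node_tree_def by (rule the_equality) (auto dest: unfolds_unique)

definition unfolds_inj :: "('v, 'a) diagram \<Rightarrow> bool" where
  "unfolds_inj D \<longleftrightarrow> (\<forall>x y t. unfolds D x t \<longrightarrow> unfolds D y t \<longrightarrow> x = y)"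

lemma unfolds_injD: "unfolds_inj D \<Longrightarrow> unfolds D x t \<Longrightarrow> unfolds D y t \<Longrightarrow> x = y"
  by (auto simp: unfolds_inj_def)

section \<open>The canonical diagram of a tree\<close>

definition canonical_diagram :: "('v, 'a) diagram \<Rightarrow> 'a dtree \<Rightarrow> bool" where
  "canonical_diagram D t \<longleftrightarrow>
     unfolds D (start D) t \<and> unfolds_inj D \<and>
     (\<forall>v \<in> inner D. \<exists>s \<in> subtrees t. unfolds D (Inner v) s)"

lemma canonical_diagram_node_tree:
  assumes "canonical_diagram D t" "v \<in> inner D"
  shows "unfolds D (Inner v) (node_tree D v)" "node_tree D v \<in> subtrees t"
proof -
  from assms obtain s where s: "s \<in> subtrees t" "unfolds D (Inner v) s"
    unfolding canonical_diagram_def by blast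
  with node_tree_eq[OF s(2)] show "unfolds D (Inner v) (node_tree D v)" "node_tree D v \<in> subtrees t"
    by simp_all
qed

lemma inj_on_node_tree:
  assumes "canonical_diagram D t"
  shows "inj_on (node_tree D) (inner D)"
proof (rule inj_onI)
  fix u v assume u: "u \<in> inner D" and v: "v \<in> inner D" and "node_tree D u = node_tree D v"
  then have "unfolds D (Inner u) (node_tree D v)"
    using canonical_diagram_node_tree(1)[OF assms u] by simp
  then have "Inner u = Inner v"
    using assms canonical_diagram_node_tree(1)[OF assms v]
    unfolding canonical_diagram_def by (blast dest: unfolds_injD)
  then show "u = v" by simp
qed

lemma image_node_tree:
  assumes "canonical_diagram D t"
  shows "node_tree D ` inner D = subtrees t - range Leaf"
proof (intro equalityI subsetI)
  fix s assume "s \<in> node_tree D ` inner D"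
  then obtain v where v: "s = node_tree D v" "v \<in> inner D" by blast
  have "node_tree D v \<notin> range Leaf"
    using canonical_diagram_node_tree(1)[OF assms v(2)] by (auto simp: unfolds_Leaf_iff)
  then show "s \<in> subtrees t - range Leaf"
    using canonical_diagram_node_tree(2)[OF assms v(2)] v(1) by simp
next
  fix s assume s: "s \<in> subtrees t - range Leaf"
  have "unfolds D (start D) t" using assms by (simp add: canonical_diagram_def)
  with unfolds_subtree s obtain x where x: "unfolds D x s" by blast
  from x s obtain v where v: "x = Inner v" "v \<in> inner D" by cases auto
  from v(2) show "s \<in> node_tree D ` inner D"
    using node_tree_eq[OF x[unfolded v(1)]] by (intro image_eqI[of _ _ v]) simp_all
qed

lemma bij_betw_node_tree:
  "canonical_diagram D t \<Longrightarrow> bij_betw (node_tree D) (inner D) (subtrees t - range Leaf)"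
  by (simp add: bij_betw_def inj_on_node_tree image_node_tree)

lemma diagram_isoI:
  assumes bij: "bij_betw f (inner D) (inner D')"
    and start: "unfolds D (start D) t" "unfolds D' (start D') t"
    and inj: "unfolds_inj D'"
    and node: "\<And>v. v \<in> inner D \<Longrightarrow> \<exists>s. unfolds D (Inner v) s \<and> unfolds D' (Inner (f v)) s"
  shows "D \<simeq> D'"
proof -
  have map_f: "x' = map_node f x" if x: "unfolds D x s" and x': "unfolds D' x' s" for x x' s
  proof (rule unfolds_injD[OF inj x'])
    from x show "unfolds D' (map_node f x) s"
    proof cases
      case (unfolds_Inner v l r)
      with node obtain s' where s': "unfolds D (Inner v) s'" "unfolds D' (Inner (f v)) s'" by blast
      have "s' = s" using s'(1) x unfolding unfolds_Inner(1) by (rule unfolds_unique)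
      with s'(2) show ?thesis by (simp add: unfolds_Inner(1))
    qed simp_all
  qed
  have "lbl D' (f v) = lbl D v \<and> succ0 D' (f v) = map_node f (succ0 D v) \<and>
      succ1 D' (f v) = map_node f (succ1 D v)" if "v \<in> inner D" for v
  proof -
    from node[OF that] obtain l r where lbl: "lbl D' (f v) = lbl D v"
      and l: "unfolds D (succ0 D v) l" "unfolds D' (succ0 D' (f v)) l"
      and r: "unfolds D (succ1 D v) r" "unfolds D' (succ1 D' (f v)) r"
      by (auto simp: unfolds_Inner_iff)
    show ?thesis using lbl map_f[OF l] map_f[OF r] by simp
  qed
  with bij map_f[OF start] show ?thesis unfolding diagram_iso_def by (intro exI[of _ f]) simp
qed

theorem canonical_diagram_unique:
  assumes "canonical_diagram D t" "canonical_diagram D' t"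
  shows "D \<simeq> D'"
proof -
  define f where "f = the_inv_into (inner D') (node_tree D') \<circ> node_tree D"
  note bij = bij_betw_node_tree[OF assms(1)] and bij' = bij_betw_node_tree[OF assms(2)]
  have f: "bij_betw f (inner D) (inner D')"
    unfolding f_def by (rule bij_betw_trans[OF bij bij_betw_the_inv_into[OF bij']])
  show ?thesis
  proof (rule diagram_isoI[OF f])
    show "unfolds D (start D) t" "unfolds D' (start D') t" "unfolds_inj D'"
      using assms by (simp_all add: canonical_diagram_def)
    fix v assume v: "v \<in> inner D"
    have "node_tree D' (f v) = node_tree D v"
      unfolding f_def o_apply by (rule f_the_inv_into_f_bij_betw[OF bij' bij_betw_apply[OF bij v]])
    then have "unfolds D' (Inner (f v)) (node_tree D v)"
      using canonical_diagram_node_tree(1)[OF assms(2) bij_betw_apply[OF f v]] by simp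
    with canonical_diagram_node_tree(1)[OF assms(1) v]
    show "\<exists>s. unfolds D (Inner v) s \<and> unfolds D' (Inner (f v)) s" by blast
  qed
qed

section \<open>Swapping the arcs\<close>

lemma swap_arcs_simps [simp]:
  "inner (swap_arcs D) = inner D" "start (swap_arcs D) = start D" "lbl (swap_arcs D) = lbl D"
  "succ0 (swap_arcs D) = succ1 D" "succ1 (swap_arcs D) = succ0 D"
  "swap_arcs (swap_arcs D) = D"
  by (simp_all add: swap_arcs_def)

lemma unfolds_swap_arcsI:
  assumes "unfolds D x t"
  shows "unfolds (swap_arcs D) x (mirror t)"
  using assms by induction (simp_all add: unfolds_Inner_iff)

lemma unfolds_swap_arcs_iff [simp]: "unfolds (swap_arcs D) x t \<longleftrightarrow> unfolds D x (mirror t)"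
  using unfolds_swap_arcsI[of D x "mirror t"] unfolds_swap_arcsI[of "swap_arcs D" x t] by auto

lemma canonical_diagram_swap_arcs:
  assumes "canonical_diagram D t"
  shows "canonical_diagram (swap_arcs D) (mirror t)"
proof -
  have "unfolds_inj (swap_arcs D)"
    using assms unfolding canonical_diagram_def unfolds_inj_def unfolds_swap_arcs_iff by blast
  then show ?thesis
    using assms by (simp add: canonical_diagram_def subtrees_mirror)
qed

section \<open>Reduction steps\<close>

abbreviation redirect :: "'v \<Rightarrow> 'v node \<Rightarrow> 'v node \<Rightarrow> 'v node" where
  "redirect v w x \<equiv> if x = Inner v then w else x"

lemma replace_node_simps [simp]:
  "inner (replace_node v w D) = inner D - {v}"
  "start (replace_node v w D) = redirect v w (start D)"
  "lbl (replace_node v w D) = lbl D"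
  "succ0 (replace_node v w D) y = redirect v w (succ0 D y)"
  "succ1 (replace_node v w D) y = redirect v w (succ1 D y)"
  by (simp_all add: replace_node_def Let_def)

text \<open>
  The trees \<open>l\<close> and \<open>r\<close> are unfoldings in the new diagram rather than in \<open>D\<close>: these are what an
  induction on the unfolding of \<open>v\<close> supplies.
\<close>

definition substitutable ::
  "('a dtree \<Rightarrow> 'a dtree \<Rightarrow> bool) \<Rightarrow> 'v \<Rightarrow> 'v node \<Rightarrow> ('v, 'a) diagram \<Rightarrow> bool" where
  "substitutable del v w D \<longleftrightarrow>
     (\<forall>l r. unfolds (replace_node v w D) (redirect v w (succ0 D v)) l \<longrightarrow>
            unfolds (replace_node v w D) (redirect v w (succ1 D v)) r \<longrightarrow>
        (\<exists>t. unfolds (replace_node v w D) w t \<and>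
             normal_form del t = normal_form del (Branch (lbl D v) l r)))"

lemma unfolds_replace_node:
  assumes "substitutable del v w D" "unfolds D x t"
  shows "\<exists>t'. unfolds (replace_node v w D) (redirect v w x) t' \<and>
    normal_form del t' = normal_form del t"
  using assms(2)
proof induction
  case (unfolds_Inner y l r)
  let ?D' = "replace_node v w D"
  from unfolds_Inner.IH obtain l' r' where
    l': "unfolds ?D' (redirect v w (succ0 D y)) l'" "normal_form del l' = normal_form del l" and
    r': "unfolds ?D' (redirect v w (succ1 D y)) r'" "normal_form del r' = normal_form del r"
    by blast
  have normal_form_eq:
    "normal_form del (Branch (lbl D y) l' r') = normal_form del (Branch (lbl D y) l r)"
    using l'(2) r'(2) by simp
  show ?case
  proof (cases "y = v")
    case True
    from assms(1) l'(1) r'(1) obtain t' where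
      "unfolds ?D' w t'" "normal_form del t' = normal_form del (Branch (lbl D v) l' r')"
      unfolding substitutable_def True by blast
    then show ?thesis unfolding True normal_form_eq[unfolded True] by (intro exI[of _ t']) simp
  next
    case False
    then have "unfolds ?D' (redirect v w (Inner y)) (Branch (lbl D y) l' r')"
      using l'(1) r'(1) unfolds_Inner.hyps(1) by (simp add: unfolds_Inner_iff)
    with normal_form_eq show ?thesis by blast
  qed
qed simp_all

lemma substitutable_duplicate:
  assumes "u \<in> inner D" "u \<noteq> v" "lbl D u = lbl D v"
    and "succ0 D u = succ0 D v" "succ1 D u = succ1 D v"
  shows "substitutable del v (Inner u) D"
  unfolding substitutable_def
proof (intro allI impI exI conjI)
  fix l r
  assume "unfolds (replace_node v (Inner u) D) (redirect v (Inner u) (succ0 D v)) l"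
    "unfolds (replace_node v (Inner u) D) (redirect v (Inner u) (succ1 D v)) r"
  then show "unfolds (replace_node v (Inner u) D) (Inner u) (Branch (lbl D v) l r)"
    using assms unfolds_Inner[of u "replace_node v (Inner u) D" l r] by (simp cong: if_cong)
qed simp

text \<open>
  The unfolding of a node may normalize to \<open>Leaf False\<close> without occurring in the normal form \<open>n\<close> of
  the root, because the deletion rule of ZDDs forgets 1-successors with that normal form.
\<close>

definition reduces_to ::
  "('a dtree \<Rightarrow> 'a dtree \<Rightarrow> bool) \<Rightarrow> ('v, 'a) diagram \<Rightarrow> 'a dtree \<Rightarrow> bool" where
  "reduces_to del D n \<longleftrightarrow>
     (\<exists>t. unfolds D (start D) t \<and> normal_form del t = n) \<and>
     (\<forall>v \<in> inner D. \<exists>s. unfolds D (Inner v) s \<and>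
        normal_form del s \<in> insert (Leaf False) (subtrees n))"

lemma reduces_to_replace_node:
  assumes "reduces_to del D n" "substitutable del v w D"
  shows "reduces_to del (replace_node v w D) n"
  unfolding reduces_to_def
proof (intro conjI ballI)
  let ?D' = "replace_node v w D"
  from assms(1) obtain t where "unfolds D (start D) t" "normal_form del t = n"
    by (auto simp: reduces_to_def)
  with unfolds_replace_node[OF assms(2)]
  show "\<exists>t. unfolds ?D' (start ?D') t \<and> normal_form del t = n"
    unfolding replace_node_simps by blast
  fix y assume y: "y \<in> inner ?D'"
  with assms(1) obtain s where s: "unfolds D (Inner y) s"
    and normal: "normal_form del s \<in> insert (Leaf False) (subtrees n)"
    by (auto simp: reduces_to_def)
  from y have "redirect v w (Inner y) = Inner y" by simp
  with unfolds_replace_node[OF assms(2) s] normal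
  show "\<exists>s. unfolds ?D' (Inner y) s \<and> normal_form del s \<in> insert (Leaf False) (subtrees n)"
    by metis
qed

lemma reduces_to_ns_step:
  assumes "ns_step D D'" "reduces_to del D n"
  shows "reduces_to del D' n"
  using assms(1)
proof cases
  case (1 u v)
  then have "substitutable del v (Inner u) D" by (intro substitutable_duplicate)
  with assms(2) show ?thesis unfolding 1(1) by (rule reduces_to_replace_node)
qed

lemma no_ns_step_unfolds_inj:
  assumes "\<nexists>D'. ns_step D D'"
  shows "unfolds_inj D"
proof -
  have "x = y" if "unfolds D x t" "unfolds D y t" for x y t
    using that
  proof (induction arbitrary: y rule: unfolds.induct)
    case (unfolds_Inner u l r)
    from unfolds_Inner.prems obtain v where v: "y = Inner v" "v \<in> inner D" "lbl D u = lbl D v"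
      "unfolds D (succ0 D v) l" "unfolds D (succ1 D v) r"
      by (auto simp: unfolds_Branch_iff)
    then have "succ0 D u = succ0 D v" "succ1 D u = succ1 D v"
      using unfolds_Inner.IH by auto
    with v unfolds_Inner.hyps(1) assms have "u = v"
      using ns_step.intros[of u D v] by blast
    with v show ?case by simp
  qed (auto simp: unfolds_Leaf_iff)
  then show ?thesis by (auto simp: unfolds_inj_def)
qed

section \<open>Deletion rules\<close>

inductive nd_step ::
  "('v node \<Rightarrow> 'v node \<Rightarrow> bool) \<Rightarrow> ('v, 'a) diagram \<Rightarrow> ('v, 'a) diagram \<Rightarrow> bool" for redundant where
  "\<lbrakk>v \<in> inner D; redundant (succ0 D v) (succ1 D v)\<rbrakk>
   \<Longrightarrow> nd_step redundant D (replace_node v (succ0 D v) D)"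

locale deletion_rule =
  fixes redundant :: "'v node \<Rightarrow> 'v node \<Rightarrow> bool" and del :: "'a dtree \<Rightarrow> 'a dtree \<Rightarrow> bool"
  assumes redundant_redirect:
      "redundant x y \<Longrightarrow> redundant (redirect v w x) (redirect v w y)"
    and del_if_redundant:
      "\<lbrakk>redundant x y; unfolds (D :: ('v, 'a) diagram) x l; unfolds D y r\<rbrakk>
       \<Longrightarrow> del (normal_form del l) (normal_form del r)"
    and redundant_if_del:
      "\<lbrakk>del l r; unfolds_inj (D :: ('v, 'a) diagram); unfolds D x l; unfolds D y r\<rbrakk>
       \<Longrightarrow> redundant x y"
    and subtrees_if_del: "del l r \<Longrightarrow> subtrees r \<subseteq> insert (Leaf False) (subtrees l)"
begin

definition reduction_step :: "('v, 'a) diagram \<Rightarrow> ('v, 'a) diagram \<Rightarrow> bool" where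
  "reduction_step D D' \<longleftrightarrow> ns_step D D' \<or> nd_step redundant D D'"

lemma normal_form_subtree:
  assumes "s \<in> subtrees t"
  shows "normal_form del s \<in> insert (Leaf False) (subtrees (normal_form del t))"
  using assms
proof (induction t)
  case (Branch a l r)
  then consider (root) "s = Branch a l r" | (left) "s \<in> subtrees l" | (right) "s \<in> subtrees r"
    by auto
  then show ?case
  proof cases
    case root
    then show ?thesis by (simp only: self_in_subtrees insertI2)
  next
    case left
    with Branch.IH(1) show ?thesis by auto
  next
    case right
    with Branch.IH(2) show ?thesis
      using subtrees_if_del[of "normal_form del l" "normal_form del r"] by auto
  qed
qed simp

lemma substitutable_redundant:
  assumes "redundant (succ0 D v) (succ1 D v)"
  shows "substitutable del v (succ0 D v) D"
  unfolding substitutable_def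
proof (intro allI impI)
  let ?w = "succ0 D v" and ?D' = "replace_node v (succ0 D v) D"
  fix l r
  assume l: "unfolds ?D' (redirect v ?w ?w) l" and r: "unfolds ?D' (redirect v ?w (succ1 D v)) r"
  then have "del (normal_form del l) (normal_form del r)"
    using del_if_redundant redundant_redirect[OF assms] by blast
  then have "normal_form del l = normal_form del (Branch (lbl D v) l r)" by simp
  moreover have "unfolds ?D' ?w l" using l by simp
  ultimately show "\<exists>t. unfolds ?D' ?w t \<and>
      normal_form del t = normal_form del (Branch (lbl D v) l r)"
    by blast
qed

lemma reduces_to_reduction_step:
  assumes "reduction_step D D'" "reduces_to del D n"
  shows "reduces_to del D' n"
  using assms(1) unfolding reduction_step_def
proof
  assume "ns_step D D'"
  then show ?thesis using assms(2) by (rule reduces_to_ns_step)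
next
  assume "nd_step redundant D D'"
  then show ?thesis
    by cases (auto intro: reduces_to_replace_node[OF assms(2)] substitutable_redundant)
qed

lemma reduces_to_rtranclp_reduction_step:
  assumes "reduction_step\<^sup>*\<^sup>* D D'" "reduces_to del D n"
  shows "reduces_to del D' n"
  using assms by induction (auto intro: reduces_to_reduction_step)

lemma normal_form_unfolds:
  assumes "unfolds D x t" "unfolds_inj D" "\<nexists>D'. nd_step redundant D D'"
  shows "normal_form del t = t"
  using assms(1)
proof induction
  case (unfolds_Inner v l r)
  have "\<not> redundant (succ0 D v) (succ1 D v)"
    using nd_step.intros[of v D redundant] unfolds_Inner.hyps(1) assms(3) by blast
  then have "\<not> del l r"
    using redundant_if_del[OF _ assms(2) unfolds_Inner.hyps(2,3)] by blast
  with unfolds_Inner.IH show ?case by simp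
qed simp_all

theorem canonical_diagram_if_exhausts_to:
  assumes "exhausts_to reduction_step D\<^sub>0 D" "reduces_to del D\<^sub>0 n"
  shows "canonical_diagram D n"
  unfolding canonical_diagram_def
proof (intro conjI ballI)
  have reduces: "reduces_to del D n" and final: "\<nexists>D'. ns_step D D'" "\<nexists>D'. nd_step redundant D D'"
    using assms reduces_to_rtranclp_reduction_step
    by (auto simp: exhausts_to_def reduction_step_def)
  show inj: "unfolds_inj D" using final(1) by (rule no_ns_step_unfolds_inj)
  note normal = normal_form_unfolds[OF _ inj final(2)]
  from reduces show "unfolds D (start D) n" by (auto simp: reduces_to_def normal)
  fix v assume "v \<in> inner D"
  with reduces obtain s where s: "unfolds D (Inner v) s" "s \<in> insert (Leaf False) (subtrees n)"
    by (auto simp: reduces_to_def normal)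
  moreover have "s \<noteq> Leaf False" using s(1) by (auto simp: unfolds_Leaf_iff)
  ultimately show "\<exists>s \<in> subtrees n. unfolds D (Inner v) s" by blast
qed

end

interpretation bdd: deletion_rule "(=)" "(=)"
  by unfold_locales (auto dest: unfolds_unique unfolds_injD)

interpretation zdd: deletion_rule "\<lambda>_ y. y = Bot" zdd_del
  by unfold_locales (auto dest: unfolds_injD[OF _ _ unfolds_Bot])

lemma bdd_step_eq_reduction_step: "bdd_step = bdd.reduction_step"
  by (auto simp: fun_eq_iff bdd_step_def bdd.reduction_step_def bnd_step.simps nd_step.simps)

lemma zdd_step_eq_reduction_step: "zdd_step = zdd.reduction_step"
  by (auto simp: fun_eq_iff zdd_step_def zdd.reduction_step_def znd_step.simps nd_step.simps)

section \<open>The complete decision tree\<close>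

primrec family_tree :: "'a set set \<Rightarrow> 'a list \<Rightarrow> 'a set \<Rightarrow> 'a dtree" where
  "family_tree S [] P = Leaf (P \<in> S)"
| "family_tree S (x # xs) P = Branch x (family_tree S xs P) (family_tree S xs (insert x P))"

definition ground_list :: "'a set \<Rightarrow> 'a rel \<Rightarrow> 'a list" where
  "ground_list E r = map (nth_smallest E r) [0..<card E]"

definition path_tree :: "'a set \<Rightarrow> 'a rel \<Rightarrow> 'a set set \<Rightarrow> bool list \<Rightarrow> 'a dtree" where
  "path_tree E r S p = family_tree S (drop (length p) (ground_list E r)) (path_set E r p)"

lemma path_set_snoc:
  "path_set E r (p @ [b]) =
     (if b then insert (nth_smallest E r (length p)) (path_set E r p) else path_set E r p)"
proof -
  have "{j. j < length (p @ [b]) \<and> (p @ [b]) ! j} =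
      (if b then insert (length p) {j. j < length p \<and> p ! j} else {j. j < length p \<and> p ! j})"
    by (auto simp: nth_append less_Suc_eq)
  then show ?thesis by (simp add: path_set_def setcompr_eq_image)
qed

lemma path_tree_Nil: "path_tree E r S [] = family_tree S (ground_list E r) {}"
  by (simp add: path_tree_def path_set_def)

lemma path_tree_leaf: "length p = card E \<Longrightarrow> path_tree E r S p = Leaf (path_set E r p \<in> S)"
  by (simp add: path_tree_def ground_list_def)

lemma path_tree_branch:
  assumes "length p < card E"
  shows "path_tree E r S p =
    Branch (nth_smallest E r (length p))
      (path_tree E r S (p @ [False])) (path_tree E r S (p @ [True]))"
  using upt_conv_Cons[OF assms]
  by (simp add: path_tree_def ground_list_def drop_map path_set_snoc)

lemma path_tree_in_subtrees:
  "length p \<le> card E \<Longrightarrow> path_tree E r S p \<in> subtrees (path_tree E r S [])"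
proof (induction p rule: rev_induct)
  case (snoc b p)
  then have "path_tree E r S (p @ [b]) \<in> subtrees (path_tree E r S p)"
    by (cases b) (simp_all add: path_tree_branch[of p])
  with snoc show ?case by (auto intro: subtrees_trans)
qed simp

lemma unfolds_tree_node:
  assumes "length p \<le> card E"
  shows "unfolds (decision_tree E r S) (tree_node E r S p) (path_tree E r S p)"
  using assms
proof (induction "card E - length p" arbitrary: p)
  case 0
  then show ?case by (simp add: tree_node_def path_tree_leaf)
next
  case (Suc k)
  then have "length p < card E" by simp
  moreover have
    "unfolds (decision_tree E r S) (tree_node E r S (p @ [b])) (path_tree E r S (p @ [b]))" for b
    using Suc.hyps(1)[of "p @ [b]"] Suc.hyps(2) by simp
  ultimately show ?case
    by (simp add: path_tree_branch tree_node_def[of E r S p] unfolds_Inner_iff decision_tree_def)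
qed

lemma reduces_to_decision_tree:
  fixes redundant :: "bool list node \<Rightarrow> bool list node \<Rightarrow> bool"
  assumes "deletion_rule redundant del"
  shows "reduces_to del (decision_tree E r S)
    (normal_form del (family_tree S (ground_list E r) {}))"
  unfolding reduces_to_def path_tree_Nil[symmetric]
proof (intro conjI ballI exI)
  interpret deletion_rule redundant del by (rule assms)
  let ?D = "decision_tree E r S"
  show "unfolds ?D (start ?D) (path_tree E r S [])"
    using unfolds_tree_node[of "[]" E r S] by (simp add: decision_tree_def)
  fix p assume p: "p \<in> inner ?D"
  then show "unfolds ?D (Inner p) (path_tree E r S p)"
    using unfolds_tree_node[of p E r S] by (simp add: decision_tree_def tree_node_def)
  show "normal_form del (path_tree E r S p) \<in>
      insert (Leaf False) (subtrees (normal_form del (path_tree E r S [])))"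
    using p by (intro normal_form_subtree path_tree_in_subtrees) (simp add: decision_tree_def)
qed simp

theorem canonical_diagram_BDD:
  "canonical_diagram (BDD E r S) (bdd_normal_form (family_tree S (ground_list E r) {}))"
  using exhausts_to_BDD[unfolded bdd_step_eq_reduction_step]
    reduces_to_decision_tree[OF bdd.deletion_rule_axioms]
  by (rule bdd.canonical_diagram_if_exhausts_to)

theorem canonical_diagram_ZDD:
  "canonical_diagram (ZDD E r S) (zdd_normal_form (family_tree S (ground_list E r) {}))"
  using exhausts_to_ZDD[unfolded zdd_step_eq_reduction_step]
    reduces_to_decision_tree[OF zdd.deletion_rule_axioms]
  by (rule zdd.canonical_diagram_if_exhausts_to)

section \<open>Enumerating the ground set\<close>

lemma bij_betw_card_below:
  assumes "finite E" "linear_order_on E r"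
  shows "bij_betw (\<lambda>e. card {x \<in> E. (x, e) \<in> r \<and> x \<noteq> e}) E {..<card E}"
proof -
  define below where "below e = {x \<in> E. (x, e) \<in> r \<and> x \<noteq> e}" for e
  have order: "trans r" "antisym r" "total_on E r"
    using assms(2) by (auto simp: linear_order_on_def partial_order_on_def preorder_on_def)
  have mono: "card (below x) < card (below y)"
    if "x \<in> E" "y \<in> E" "(x, y) \<in> r" "x \<noteq> y" for x y
  proof (rule psubset_card_mono)
    have "below x \<subseteq> below y" "x \<in> below y" "x \<notin> below x"
      using that order by (auto simp: below_def dest: transD antisymD)
    then show "below x \<subset> below y" by blast
  qed (use assms(1) in \<open>simp add: below_def\<close>)
  have inj: "inj_on (\<lambda>e. card (below e)) E"
  proof (rule inj_onI)
    fix x y assume "x \<in> E" "y \<in> E" "card (below x) = card (below y)"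
    then show "x = y" using mono[of x y] mono[of y x] order(3) by (auto simp: total_on_def)
  qed
  have "card (below e) < card E" if "e \<in> E" for e
    using that by (intro psubset_card_mono[OF assms(1)]) (auto simp: below_def)
  then have "(\<lambda>e. card (below e)) ` E = {..<card E}"
    using card_image[OF inj] by (intro card_subset_eq) auto
  with inj show ?thesis by (simp add: bij_betw_def below_def)
qed

lemma bij_betw_nth_smallest:
  assumes "finite E" "linear_order_on E r"
  shows "bij_betw (nth_smallest E r) {..<card E} E"
proof -
  have "nth_smallest E r = the_inv_into E (\<lambda>e. card {x \<in> E. (x, e) \<in> r \<and> x \<noteq> e})"
    by (simp add: fun_eq_iff nth_smallest_def the_inv_into_def)
  with bij_betw_the_inv_into[OF bij_betw_card_below[OF assms]] show ?thesis by simp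
qed

lemma distinct_ground_list:
  "finite E \<Longrightarrow> linear_order_on E r \<Longrightarrow> distinct (ground_list E r)"
  using bij_betw_nth_smallest[of E r]
  by (simp add: ground_list_def distinct_map bij_betw_def lessThan_atLeast0)

lemma set_ground_list:
  "finite E \<Longrightarrow> linear_order_on E r \<Longrightarrow> set (ground_list E r) = E"
  using bij_betw_nth_smallest[of E r]
  by (simp add: ground_list_def bij_betw_def lessThan_atLeast0)

section \<open>ZDD semantics of binary trees\<close>

primrec zdd_family :: "'a dtree \<Rightarrow> 'a set set" where
  "zdd_family (Leaf b) = (if b then {{}} else {})"
| "zdd_family (Branch a l r) = zdd_family l \<union> insert a ` zdd_family r"

lemma zdd_family_normal_form [simp]: "zdd_family (zdd_normal_form t) = zdd_family t"
  by (induction t) auto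

lemma zdd_normal_form_eq_Leaf_False_iff: "zdd_normal_form t = Leaf False \<longleftrightarrow> zdd_family t = {}"
  by (induction t) auto

definition completions :: "'a set set \<Rightarrow> 'a set \<Rightarrow> 'a set \<Rightarrow> 'a set set" where
  "completions S Y P = {X. X \<subseteq> Y \<and> P \<union> X \<in> S}"

lemma completions_insert:
  "completions S (insert x Y) P = completions S Y P \<union> insert x ` completions S Y (insert x P)"
proof (intro equalityI subsetI)
  fix X assume X: "X \<in> completions S (insert x Y) P"
  show "X \<in> completions S Y P \<union> insert x ` completions S Y (insert x P)"
  proof (cases "x \<in> X")
    case True
    then have "X = insert x (X - {x})" "insert x P \<union> (X - {x}) = P \<union> X" by auto
    with X have "X \<in> insert x ` completions S Y (insert x P)"
      by (intro image_eqI[of _ _ "X - {x}"]) (auto simp: completions_def)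
    then show ?thesis ..
  qed (use X in \<open>auto simp: completions_def\<close>)
qed (auto simp: completions_def)

lemma zdd_family_tree: "zdd_family (family_tree S xs P) = completions S (set xs) P"
  by (induction xs arbitrary: P) (simp_all add: completions_insert, auto simp: completions_def)

lemma zdd_normal_form_family_tree_eq_Leaf_False_iff:
  "zdd_normal_form (family_tree S xs P) = Leaf False \<longleftrightarrow> completions S (set xs) P = {}"
  by (simp add: zdd_normal_form_eq_Leaf_False_iff zdd_family_tree)

section \<open>Matroids\<close>

lemma indep_sets_mono: "I \<in> indep_sets \<B> \<Longrightarrow> J \<subseteq> I \<Longrightarrow> J \<in> indep_sets \<B>"
  by (auto simp: indep_sets_def)

lemma completions_dependent: "P \<notin> indep_sets \<B> \<Longrightarrow> completions \<B> Y P = {}"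
  by (auto simp: completions_def indep_sets_def)

context matroid
begin

lemma finite_basis: "B \<in> \<B> \<Longrightarrow> finite B"
  using bases_subset finite_ground by (auto intro: finite_subset)

lemma basis_extension_card:
  assumes "B\<^sub>1 \<in> \<B>" "B\<^sub>2 \<in> \<B>" "I \<subseteq> B\<^sub>1"
  shows "\<exists>B \<in> \<B>. I \<subseteq> B \<and> B \<subseteq> I \<union> B\<^sub>2 \<and> card B = card B\<^sub>1"
  using assms(1,3)
proof (induction "card (B\<^sub>1 - (I \<union> B\<^sub>2))" arbitrary: B\<^sub>1 rule: less_induct)
  case less
  have "finite B\<^sub>1" using less.prems(1) by (rule finite_basis)
  show ?case
  proof (cases "B\<^sub>1 \<subseteq> I \<union> B\<^sub>2")
    case True
    with less.prems show ?thesis by blast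
  next
    case False
    then obtain x where x: "x \<in> B\<^sub>1" "x \<notin> I" "x \<notin> B\<^sub>2" by blast
    with basis_exchange[of B\<^sub>1 B\<^sub>2 x] less.prems(1) assms(2) obtain y
      where y: "y \<in> B\<^sub>2 - B\<^sub>1" "insert y (B\<^sub>1 - {x}) \<in> \<B>" by auto
    let ?B = "insert y (B\<^sub>1 - {x})"
    have "?B - (I \<union> B\<^sub>2) = (B\<^sub>1 - (I \<union> B\<^sub>2)) - {x}" using y by auto
    then have "card (?B - (I \<union> B\<^sub>2)) < card (B\<^sub>1 - (I \<union> B\<^sub>2))"
      using x \<open>finite B\<^sub>1\<close> card_Diff1_less[of "B\<^sub>1 - (I \<union> B\<^sub>2)" x] by simp
    moreover have "I \<subseteq> ?B" using less.prems(2) x by auto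
    ultimately have "\<exists>B \<in> \<B>. I \<subseteq> B \<and> B \<subseteq> I \<union> B\<^sub>2 \<and> card B = card ?B"
      using y(2) by (intro less.hyps)
    moreover have "card ?B = card B\<^sub>1"
      using x y \<open>finite B\<^sub>1\<close> card_Suc_Diff1[of B\<^sub>1 x] by simp
    ultimately show ?thesis by simp
  qed
qed

lemma basis_extension:
  assumes "I \<in> indep_sets \<B>" "B \<in> \<B>"
  shows "\<exists>B' \<in> \<B>. I \<subseteq> B' \<and> B' \<subseteq> I \<union> B"
proof -
  from assms(1) obtain B\<^sub>1 where "B\<^sub>1 \<in> \<B>" "I \<subseteq> B\<^sub>1" by (auto simp: indep_sets_def)
  from basis_extension_card[OF this(1) assms(2) this(2)] show ?thesis by blast
qed

lemma card_basis_le: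
  assumes "B\<^sub>1 \<in> \<B>" "B\<^sub>2 \<in> \<B>"
  shows "card B\<^sub>1 \<le> card B\<^sub>2"
proof -
  from basis_extension_card[OF assms, of "{}"] obtain B
    where "B \<subseteq> B\<^sub>2" "card B = card B\<^sub>1" by auto
  with card_mono[OF finite_basis[OF assms(2)]] show ?thesis by metis
qed

lemma card_basis_eq: "B\<^sub>1 \<in> \<B> \<Longrightarrow> B\<^sub>2 \<in> \<B> \<Longrightarrow> card B\<^sub>1 = card B\<^sub>2"
  by (simp add: card_basis_le le_antisym)

definition spanning :: "'a set \<Rightarrow> bool" where
  "spanning Y \<longleftrightarrow> (\<exists>B \<in> \<B>. B \<subseteq> Y)"

lemma dual_indep_iff_spanning_complement:
  assumes "Q \<subseteq> E"
  shows "Q \<in> indep_sets (dual_bases E \<B>) \<longleftrightarrow> spanning (E - Q)"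
proof -
  have "Q \<in> indep_sets (dual_bases E \<B>) \<longleftrightarrow> (\<exists>B \<in> \<B>. Q \<subseteq> E - B)"
    by (auto simp: indep_sets_def dual_bases_def)
  also have "\<dots> \<longleftrightarrow> (\<exists>B \<in> \<B>. B \<subseteq> E - Q)"
  proof (rule bex_cong[OF refl])
    show "Q \<subseteq> E - B \<longleftrightarrow> B \<subseteq> E - Q" if "B \<in> \<B>" for B
      using assms that bases_subset by auto
  qed
  finally show ?thesis by (simp only: spanning_def)
qed

definition maximal_indep_in :: "'a set \<Rightarrow> 'a set \<Rightarrow> bool" where
  "maximal_indep_in Y P \<longleftrightarrow>
     P \<in> indep_sets \<B> \<and> P \<subseteq> Y \<and> (\<forall>y \<in> Y - P. insert y P \<notin> indep_sets \<B>)"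

lemma maximal_indep_in_empty: "maximal_indep_in {} {}"
  using bases_nonempty by (auto simp: maximal_indep_in_def indep_sets_def)

lemma maximal_indep_in_insert_indep:
  assumes "maximal_indep_in Y P" "insert x P \<in> indep_sets \<B>"
  shows "maximal_indep_in (insert x Y) (insert x P)"
proof -
  have "insert y (insert x P) \<notin> indep_sets \<B>" if "y \<in> Y - P" for y
    using assms(1) that indep_sets_mono[of "insert y (insert x P)" \<B> "insert y P"]
    by (auto simp: maximal_indep_in_def)
  then show ?thesis using assms by (auto simp: maximal_indep_in_def)
qed

lemma maximal_indep_in_insert_dependent:
  "maximal_indep_in Y P \<Longrightarrow> insert x P \<notin> indep_sets \<B> \<Longrightarrow> maximal_indep_in (insert x Y) P"
  by (auto simp: maximal_indep_in_def)

lemma spanning_iff_maximal_indep_basis: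
  assumes "maximal_indep_in Y P"
  shows "spanning Y \<longleftrightarrow> P \<in> \<B>"
proof
  assume "spanning Y"
  then obtain B where B: "B \<in> \<B>" "B \<subseteq> Y" by (auto simp: spanning_def)
  with basis_extension assms obtain B' where B': "B' \<in> \<B>" "P \<subseteq> B'" "B' \<subseteq> P \<union> B"
    unfolding maximal_indep_in_def by meson
  have "B' \<subseteq> P"
  proof
    fix y assume y: "y \<in> B'"
    with B' have "insert y P \<in> indep_sets \<B>" by (auto simp: indep_sets_def)
    moreover have "y \<in> Y" using y B B' assms by (auto simp: maximal_indep_in_def)
    ultimately show "y \<in> P" using assms by (auto simp: maximal_indep_in_def)
  qed
  with B' show "P \<in> \<B>" by (simp add: subset_antisym)
qed (use assms in \<open>auto simp: maximal_indep_in_def spanning_def\<close>)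

lemma completions_insert_disjoint:
  assumes "x \<notin> P" "x \<notin> Y"
  shows "completions \<B> Y P \<inter> completions \<B> Y (insert x P) = {}"
proof -
  have False if "X \<subseteq> Y" "P \<union> X \<in> \<B>" "insert x (P \<union> X) \<in> \<B>" for X
  proof -
    have "card (insert x (P \<union> X)) = Suc (card (P \<union> X))"
      using that assms finite_basis by (intro card_insert_disjoint) auto
    then show False using card_basis_eq[OF that(2,3)] by simp
  qed
  then show ?thesis by (auto simp: completions_def)
qed

lemma completions_insert_nonempty:
  assumes "insert x P \<in> indep_sets \<B>" "completions \<B> Y P \<noteq> {}"
  shows "completions \<B> Y (insert x P) \<noteq> {}"
proof -
  from assms(2) obtain X where X: "X \<subseteq> Y" "P \<union> X \<in> \<B>" by (auto simp: completions_def)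
  from basis_extension[OF assms(1) X(2)] obtain B
    where B: "B \<in> \<B>" "insert x P \<subseteq> B" "B \<subseteq> insert x P \<union> (P \<union> X)" by blast
  then have "insert x P \<union> (B - insert x P) = B" "B - insert x P \<subseteq> Y"
    using X(1) by auto
  with B(1) have "B - insert x P \<in> completions \<B> Y (insert x P)"
    by (simp only: completions_def mem_Collect_eq)
  then show ?thesis by blast
qed

section \<open>Bases and dual independent sets\<close>

lemma zdd_normal_form_bases_eq_iff:
  assumes "x \<notin> set xs" "x \<notin> P" "insert x P \<in> indep_sets \<B>"
  shows "zdd_normal_form (family_tree \<B> xs P) = zdd_normal_form (family_tree \<B> xs (insert x P)) \<longleftrightarrow>
    zdd_normal_form (family_tree \<B> xs (insert x P)) = Leaf False" (is "?l = ?r \<longleftrightarrow> _")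
proof
  assume "?l = ?r"
  then have "zdd_family ?l = zdd_family ?r" by (rule arg_cong)
  then have "completions \<B> (set xs) P = completions \<B> (set xs) (insert x P)"
    by (simp add: zdd_family_tree)
  with completions_insert_disjoint[OF assms(2,1)] show "?r = Leaf False"
    by (simp add: zdd_normal_form_family_tree_eq_Leaf_False_iff)
next
  assume r: "?r = Leaf False"
  then have "?l = Leaf False"
    using completions_insert_nonempty[OF assms(3)]
    unfolding zdd_normal_form_family_tree_eq_Leaf_False_iff by blast
  with r show "?l = ?r" by simp
qed

lemma bdd_normal_form_dual_indep_sets:
  assumes "distinct xs" "set xs \<subseteq> E" "Q \<subseteq> E - set xs" "maximal_indep_in (E - set xs - Q) P"
  shows "bdd_normal_form (family_tree (indep_sets (dual_bases E \<B>)) xs Q) =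
    mirror (zdd_normal_form (family_tree \<B> xs P))"
  using assms
proof (induction xs arbitrary: Q P)
  case Nil
  then show ?case
    by (simp add: dual_indep_iff_spanning_complement spanning_iff_maximal_indep_basis)
next
  case (Cons x xs)
  let ?b = "\<lambda>Q. bdd_normal_form (family_tree (indep_sets (dual_bases E \<B>)) xs Q)"
  let ?z = "\<lambda>P. zdd_normal_form (family_tree \<B> xs P)"
  let ?Y = "E - set (x # xs) - Q"
  have x: "x \<notin> set xs" "x \<notin> P" and xs: "distinct xs" "set xs \<subseteq> E"
    and Q: "Q \<subseteq> E - set xs" "insert x Q \<subseteq> E - set xs"
    and Y: "E - set xs - insert x Q = ?Y" "E - set xs - Q = insert x ?Y"
    using Cons.prems by (auto simp: maximal_indep_in_def)
  have arc1: "?b (insert x Q) = mirror (?z P)"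
    using Cons.IH[OF xs Q(2)] Cons.prems(4) unfolding Y(1) .
  have arc0: "?b Q = mirror (?z P')" if "maximal_indep_in (insert x ?Y) P'" for P'
    using Cons.IH[OF xs Q(1)] that unfolding Y(2) .
  show ?case
  proof (cases "insert x P \<in> indep_sets \<B>")
    case True
    then have "?b Q = mirror (?z (insert x P))"
      using arc0 maximal_indep_in_insert_indep Cons.prems(4) by blast
    then show ?thesis using arc1 zdd_normal_form_bases_eq_iff[OF x True] by auto
  next
    case False
    then have "?b Q = mirror (?z P)"
      using arc0 maximal_indep_in_insert_dependent Cons.prems(4) by blast
    moreover have "?z (insert x P) = Leaf False"
      using completions_dependent[OF False]
      by (simp add: zdd_normal_form_family_tree_eq_Leaf_False_iff)
    ultimately show ?thesis using arc1 by simp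
  qed
qed

end

theorem theorem3p6:
  fixes E :: "'a set" and \<B> :: "'a set set" and r :: "'a rel"
  assumes "matroid E \<B>" and "linear_order_on E r"
  shows "BDD E r (indep_sets (dual_bases E \<B>)) \<simeq> swap_arcs (ZDD E r \<B>)"
proof (rule canonical_diagram_unique)
  interpret matroid E \<B> by (rule assms(1))
  let ?z = "zdd_normal_form (family_tree \<B> (ground_list E r) {})"
  have
    "bdd_normal_form (family_tree (indep_sets (dual_bases E \<B>)) (ground_list E r) {}) = mirror ?z"
    using distinct_ground_list[OF finite_ground assms(2)]
      set_ground_list[OF finite_ground assms(2)]
    by (intro bdd_normal_form_dual_indep_sets) (simp_all add: maximal_indep_in_empty)
  then show "canonical_diagram (BDD E r (indep_sets (dual_bases E \<B>))) (mirror ?z)"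
    using canonical_diagram_BDD by metis
  show "canonical_diagram (swap_arcs (ZDD E r \<B>)) (mirror ?z)"
    by (rule canonical_diagram_swap_arcs[OF canonical_diagram_ZDD])
qed

end
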